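(* There exist real rank-one matrices $A_1,A_2\in\mathbb M_2(\mathbb R)$ such that \[ \frac{\|A_1+A_2\|_{3/2}}{\big\||A_1|+|A_2|\big\|_{3/2}}>\frac{207}{200}>C^{\mathrm{TZ}}_{3/2,2}. \] Consequently, the Tang--Zhang conjecture, i.e. the assertion that $c_p(m)=C^{\mathrm{TZ}}_{p,m}$ for every integer $m\ge 2$ and every finite $p>1$, is false.
   Context: For $A\in\mathbb M_n(\mathbb C)$ (complex $n\times n$ matrices), $|A|=(A^*A)^{1/2}$, and $\|A\|_p=(\operatorname{Tr}|A|^p)^{1/p}$ is the Schatten $p$-norm for $1\le p<\infty$. For $m\ge 2$, the dimension-free best constant is \[ c_p(m)=\sup_{n\ge1}\ \sup_{(A_1,\ldots,A_m)\ne 0,\ A_k\in\mathbb M_n(\mathbb C)}\frac{\left\|\sum_{k=1}^m A_k\right\|_p}{\left\|\sum_{k=1}^m |A_k|\right\|_p}. \] For finite $p>1$ and integer $m\ge2$, let $x_{p,m}>1$ be the unique solution in $(1,\infty)$ of $x^p-2x-(m-1)=0$, and define \[ C^{\mathrm{TZ}}_{p,m}=\frac{\sqrt{x_{p,m}(x_{p,m}+m-1)}}{(x_{p,m}^p+m-1)^{1/p}}. \] In particular $C^{\mathrm{TZ}}_{3/2,2}=\dfrac{\sqrt{x(x+1)}}{(x^{3/2}+1)^{2/3}}$, where $x>1$ solves $x^{3/2}-2x-1=0$. *)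

theory Defs
  imports
    "HOL-Library.Extended_Real"
    "Jordan_Normal_Form.Schur_Decomposition"
    "Jordan_Normal_Form.DL_Rank"
begin

(* Functional calculus for the real power of a positive semidefinite B:
   if B = U diag(d) U^* with U unitary and d >= 0, then B^s = U diag(d^s) U^*,
   and this does not depend on the chosen diagonalization. Used only for s > 0,
   where 0 powr s = 0. The value is unspecified if B is not positive semidefinite. *)
definition psd_powr :: "complex mat \<Rightarrow> real \<Rightarrow> complex mat" where
  "psd_powr B s = (let n = dim_row B in
     THE C. \<exists>U \<in> carrier_mat n n. \<exists>d :: nat \<Rightarrow> real.
       mat_adjoint U * U = 1\<^sub>m n \<and> (\<forall>i<n. d i \<ge> 0) \<and>
       B = U * mat_diag n (\<lambda>i. complex_of_real (d i)) * mat_adjoint U \<and>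
       C = U * mat_diag n (\<lambda>i. complex_of_real (d i powr s)) * mat_adjoint U)"

definition mat_abs :: "complex mat \<Rightarrow> complex mat" where
  "mat_abs A = psd_powr (mat_adjoint A * A) (1 / 2)"

definition mat_trace :: "complex mat \<Rightarrow> complex" where
  "mat_trace A = (\<Sum>i<dim_row A. A $$ (i, i))"

(* The trace of |A|^p is a nonnegative real; Re only changes its type. *)
definition schatten_norm :: "real \<Rightarrow> complex mat \<Rightarrow> real" where
  "schatten_norm p A = Re (mat_trace (psd_powr (mat_abs A) p)) powr (1 / p)"

(* The supremum is taken in the extended reals, so no boundedness is presupposed.
   For a nonzero tuple the denominator is positive, so "/" is a genuine quotient. *)
definition best_const :: "real \<Rightarrow> nat \<Rightarrow> ereal" where
  "best_const p m = Sup {ereal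
       (schatten_norm p (\<Oplus>\<^bsub>module_mat TYPE(complex) n n\<^esub>k\<in>{1..m}. A k) /
        schatten_norm p (\<Oplus>\<^bsub>module_mat TYPE(complex) n n\<^esub>k\<in>{1..m}. mat_abs (A k)))
     | n (A :: nat \<Rightarrow> complex mat).
       n \<ge> 1 \<and> (\<forall>k\<in>{1..m}. A k \<in> carrier_mat n n) \<and> (\<exists>k\<in>{1..m}. A k \<noteq> 0\<^sub>m n n)}"

definition TZ_root :: "real \<Rightarrow> nat \<Rightarrow> real" where
  "TZ_root p m = (THE x. x > 1 \<and> x powr p - 2 * x - (real m - 1) = 0)"

definition TZ_const :: "real \<Rightarrow> nat \<Rightarrow> real" where
  "TZ_const p m = (let x = TZ_root p m in
     sqrt (x * (x + real m - 1)) / (x powr p + real m - 1) powr (1 / p))"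

end

theory Submission
  imports Defs
begin

text \<open>
  Mirror symmetry makes every norm in the counterexample explicit. For $u = (a, b)$ and
  $v = (c, s)$ with positive entries, let $A_1 = u v^T$, and let $A_2$ be the product of the
  mirrored vectors $(a, -b)$ and $(c, -s)$. The off-diagonal entries cancel in both sums:
  $A_1 + A_2 = 2\,\mathrm{diag}(ac, bs)$, and, since $|u v^T| = (|u| / |v|)\, v v^T$,
  $|A_1| + |A_2| = 2 (|u| / |v|)\,\mathrm{diag}(c^2, s^2)$. For $|u| = |v| = 1$ the ratio of
  the two norms is therefore
  \[ \left(\frac{(ac)^{3/2} + (bs)^{3/2}}{c^3 + s^3}\right)^{2/3}. \]

  For $b = 0$ and $X = c^2 / s^2$ this is $\sqrt{X (X + 1)} / (X^{3/2} + 1)^{2/3}$. Its critical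
  point is the root of $X^{3/2} = 2 X + 1$, and its value there is the Tang--Zhang constant, about
  $1.0346$. That value is not optimal: turning $u$ by a small angle $\varphi$ lowers
  $(ac)^{3/2}$ only by a quantity of order $\varphi^2$, but it adds $(bs)^{3/2}$, which is of
  order $\varphi^{3/2}$. The directions $u = (84, 13)$ and $v = (15, 8)$, of lengths $85$ and
  $17$, lie in the resulting region where the ratio exceeds $1.035$ (it is about $1.0354$ there),
  and they give matrices with integer entries throughout.

  Three ingredients remain. The function \<^const>\<open>psd_powr\<close> can be computed from any unitary
  diagonalization (\<open>psd_powr_eq\<close>), which yields the norm of a diagonal matrix
  (\<open>schatten_norm_mat_diag\<close>) and the absolute value of a rank-one matrix
  (\<open>mat_abs_outer2\<close>). The root of $x^{3/2} = 2 x + 1$ is bounded from above, which bounds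
  the Tang--Zhang constant (\<open>TZ_const_three_halves\<close>). Finally the ratio of the two
  explicit matrices is estimated from below (\<open>witness_ratio\<close>).
\<close>

section \<open>Powers of positive semidefinite matrices\<close>

lemma mat_adjoint_carrier [simp]:
  "A \<in> carrier_mat n m \<Longrightarrow> mat_adjoint A \<in> carrier_mat m n"
  by (auto simp: mat_adjoint_def)

lemma mat_adjoint_dim [simp]:
  "dim_row (mat_adjoint A) = dim_col A" "dim_col (mat_adjoint A) = dim_row A"
  by (simp_all add: mat_adjoint_def)

lemma mat_adjoint_index:
  "i < dim_col A \<Longrightarrow> j < dim_row A \<Longrightarrow> mat_adjoint A $$ (i, j) = conjugate (A $$ (j, i))"
  by (simp add: mat_adjoint_def mat_of_rows_index)



text \<open>
  The unitary $W = V^* U$ intertwines the two diagonal matrices, so $W_{ij} d_j = e_i W_{ij}$, and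
  hence $W_{ij} \neq 0$ only where $d_j = e_i$. There the new diagonal entries agree as well, so
  $W$ also intertwines them. This is what makes the definite description in
  \<^const>\<open>psd_powr\<close> denote.
\<close>
lemma diagonalization_calculus_unique:
  fixes U V :: "complex mat" and d e f g :: "nat \<Rightarrow> complex"
  assumes U: "U \<in> carrier_mat n n" "mat_adjoint U * U = 1\<^sub>m n"
    and V: "V \<in> carrier_mat n n" "mat_adjoint V * V = 1\<^sub>m n"
    and eq: "U * mat_diag n d * mat_adjoint U = V * mat_diag n e * mat_adjoint V"
    and fg: "\<And>i j. i < n \<Longrightarrow> j < n \<Longrightarrow> d j = e i \<Longrightarrow> f j = g i"
  shows "U * mat_diag n f * mat_adjoint U = V * mat_diag n g * mat_adjoint V"
proof -
  let ?U' = "mat_adjoint U" and ?V' = "mat_adjoint V"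
  have U': "?U' \<in> carrier_mat n n" and V': "?V' \<in> carrier_mat n n"
    using U V by auto
  have UU': "U * ?U' = 1\<^sub>m n" and VV': "V * ?V' = 1\<^sub>m n"
    using mat_mult_left_right_inverse[OF U' U(1)] mat_mult_left_right_inverse[OF V' V(1)] U V
    by auto
  define W where "W = ?V' * U"
  have W: "W \<in> carrier_mat n n"
    using U V' by (auto simp: W_def)
  note assoc = assoc_mult_mat[of _ n n _ n _ n]
  note carrier = mult_carrier_mat[of _ n n _ n]
  have "W * mat_diag n d = ?V' * (U * mat_diag n d * ?U') * U"
    using U U' V' by (simp add: W_def assoc carrier right_mult_one_mat[of _ n n])
  also have "\<dots> = mat_diag n e * W"
  proof -
    have "?V' * (V * mat_diag n e * ?V') * U = (?V' * V) * (mat_diag n e * W)"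
      using U(1) V(1) V' by (simp add: W_def assoc carrier)
    then show ?thesis
      using V W by (simp add: eq carrier left_mult_one_mat[of _ n n])
  qed
  finally have *: "W * mat_diag n d = mat_diag n e * W" .
  have entry: "W $$ (i, j) * f j = g i * W $$ (i, j)" if "i < n" "j < n" for i j
  proof -
    have "W $$ (i, j) * d j = e i * W $$ (i, j)"
      using arg_cong[OF *, of "\<lambda>M. M $$ (i, j)"] that
      by (simp add: mat_diag_mult_left[OF W] mat_diag_mult_right[OF W])
    then have "W $$ (i, j) = 0 \<or> d j = e i"
      by auto
    then show ?thesis
      using fg that by auto
  qed
  have **: "W * mat_diag n f = mat_diag n g * W"
    unfolding mat_diag_mult_left[OF W] mat_diag_mult_right[OF W]
    by (rule cong_mat) (auto simp: entry)
  have "U * mat_diag n f * ?U' = (V * ?V') * U * mat_diag n f * ?U'"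
    using U by (simp add: VV')
  also have "\<dots> = V * (W * mat_diag n f) * ?U'"
    using U U' V V' by (simp add: W_def assoc carrier)
  also have "\<dots> = V * mat_diag n g * ?V' * (U * ?U')"
    using U(1) V(1) V' unfolding ** by (simp add: W_def assoc carrier)
  also have "\<dots> = V * mat_diag n g * ?V'"
    using V V' by (simp add: UU')
  finally show ?thesis .
qed

lemma psd_powr_eq:
  assumes U: "U \<in> carrier_mat n n" "mat_adjoint U * U = 1\<^sub>m n"
    and d: "\<And>i. i < n \<Longrightarrow> 0 \<le> d i"
    and B: "B = U * mat_diag n (\<lambda>i. complex_of_real (d i)) * mat_adjoint U"
  shows "psd_powr B s = U * mat_diag n (\<lambda>i. complex_of_real (d i powr s)) * mat_adjoint U"
proof -
  have "dim_row B = n"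
    using U B by auto
  moreover have "(THE C. \<exists>V\<in>carrier_mat n n. \<exists>e :: nat \<Rightarrow> real.
       mat_adjoint V * V = 1\<^sub>m n \<and> (\<forall>i<n. e i \<ge> 0) \<and>
       B = V * mat_diag n (\<lambda>i. complex_of_real (e i)) * mat_adjoint V \<and>
       C = V * mat_diag n (\<lambda>i. complex_of_real (e i powr s)) * mat_adjoint V)
    = U * mat_diag n (\<lambda>i. complex_of_real (d i powr s)) * mat_adjoint U"
  proof (rule the_equality)
    fix C
    assume "\<exists>V\<in>carrier_mat n n. \<exists>e :: nat \<Rightarrow> real.
       mat_adjoint V * V = 1\<^sub>m n \<and> (\<forall>i<n. e i \<ge> 0) \<and>
       B = V * mat_diag n (\<lambda>i. complex_of_real (e i)) * mat_adjoint V \<and>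
       C = V * mat_diag n (\<lambda>i. complex_of_real (e i powr s)) * mat_adjoint V"
    then obtain V and e :: "nat \<Rightarrow> real" where V: "V \<in> carrier_mat n n" "mat_adjoint V * V = 1\<^sub>m n"
      and BV: "B = V * mat_diag n (\<lambda>i. complex_of_real (e i)) * mat_adjoint V"
      and C: "C = V * mat_diag n (\<lambda>i. complex_of_real (e i powr s)) * mat_adjoint V"
      by blast
    show "C = U * mat_diag n (\<lambda>i. complex_of_real (d i powr s)) * mat_adjoint U"
      unfolding C
      by (rule diagonalization_calculus_unique[OF V U BV[symmetric, unfolded B]]) simp
  qed (use assms in blast)
  ultimately show ?thesis
    by (simp add: psd_powr_def Let_def)
qed

lemma psd_powr_mat_diag:
  assumes "\<And>i. i < n \<Longrightarrow> 0 \<le> d i"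
  shows "psd_powr (mat_diag n (\<lambda>i. complex_of_real (d i))) s
    = mat_diag n (\<lambda>i. complex_of_real (d i powr s))"
proof -
  have adj: "mat_adjoint (1\<^sub>m n :: complex mat) = 1\<^sub>m n"
    by (rule eq_matI) (auto simp: mat_adjoint_index)
  show ?thesis
    using psd_powr_eq[of "1\<^sub>m n" n d "mat_diag n (\<lambda>i. complex_of_real (d i))" s] assms
    by (simp add: adj left_mult_one_mat[OF mat_diag_dim] right_mult_one_mat[OF mat_diag_dim])
qed

lemma schatten_norm_mat_diag:
  assumes d: "\<And>i. i < n \<Longrightarrow> 0 \<le> d i"
  shows "schatten_norm p (mat_diag n (\<lambda>i. complex_of_real (d i)))
    = (\<Sum>i<n. d i powr p) powr (1 / p)"
proof -
  let ?D = "mat_diag n (\<lambda>i. complex_of_real (d i))"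
  have "mat_adjoint ?D = ?D"
    by (rule eq_matI) (auto simp: mat_adjoint_index mat_diag_def)
  then have "mat_adjoint ?D * ?D = mat_diag n (\<lambda>i. complex_of_real (d i * d i))"
    by simp
  then have "mat_abs ?D = mat_diag n (\<lambda>i. complex_of_real ((d i * d i) powr (1 / 2)))"
    using psd_powr_mat_diag[of n "\<lambda>i. d i * d i" "1 / 2"] d by (simp add: mat_abs_def)
  also have "\<dots> = ?D"
    using d by (auto simp: mat_diag_def powr_half_sqrt intro!: eq_matI)
  finally have "psd_powr (mat_abs ?D) p = mat_diag n (\<lambda>i. complex_of_real (d i powr p))"
    using psd_powr_mat_diag[OF d] by simp
  then show ?thesis
    by (simp add: schatten_norm_def mat_trace_def mat_diag_def)
qed

section \<open>Real rank-one matrices of order two\<close>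

definition outer2 :: "real \<Rightarrow> real \<Rightarrow> real \<Rightarrow> real \<Rightarrow> real mat" where
  "outer2 a b c s = mat_of_rows_list 2 [[a * c, a * s], [b * c, b * s]]"

lemma outer2_carrier [simp]: "outer2 a b c s \<in> carrier_mat 2 2"
  by (auto simp: outer2_def mat_of_rows_list_def numeral_2_eq_2)

lemma outer2_dim [simp]: "dim_row (outer2 a b c s) = 2" "dim_col (outer2 a b c s) = 2"
  using outer2_carrier[of a b c s] unfolding carrier_mat_def by auto

lemma outer2_index [simp]:
  "outer2 a b c s $$ (0, 0) = a * c" "outer2 a b c s $$ (0, Suc 0) = a * s"
  "outer2 a b c s $$ (Suc 0, 0) = b * c" "outer2 a b c s $$ (Suc 0, Suc 0) = b * s"
  by (auto simp: outer2_def mat_of_rows_list_def)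

lemma lessThan_2: "{..<2::nat} = {0, 1}" "{0..<2::nat} = {0, 1}"
  by auto

lemma less_2_cases: "i < (2::nat) \<longleftrightarrow> i = 0 \<or> i = Suc 0"
  by auto

lemma rank_outer2_le: "vec_space.rank 2 (outer2 a b c s) \<le> 1"
  by (rule vec_space.rank_le_1_product_entries[where f = "\<lambda>i. if i = 0 then a else b"
        and g = "\<lambda>j. if j = 0 then c else s", OF outer2_carrier]) (auto simp: less_2_cases)

text \<open>
  Since $(u v^T)^* (u v^T) = |u|^2 v v^T$ has the eigenvalues $|u|^2 |v|^2$ and $0$ with eigenvectors
  $v$ and $v^\perp$, its square root is $(|u| / |v|)\, v v^T$. Here $p = |u|$ and $q = |v|$.
\<close>
lemma mat_abs_outer2:
  assumes p: "0 \<le> p" "a\<^sup>2 + b\<^sup>2 = p\<^sup>2" and q: "0 < q" "c\<^sup>2 + s\<^sup>2 = q\<^sup>2"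
  shows "mat_abs (map_mat complex_of_real (outer2 a b c s))
    = map_mat complex_of_real (outer2 (p / q * c) (p / q * s) c s)"
proof -
  let ?A = "map_mat complex_of_real (outer2 a b c s)"
  \<comment> \<open>the rotation whose columns are the unit vectors along $v$ and $v^\perp$\<close>
  define U where "U = map_mat complex_of_real (mat_of_rows_list 2 [[c / q, - s / q], [s / q, c / q]])"
  have U: "U \<in> carrier_mat 2 2"
    by (auto simp: U_def mat_of_rows_list_def)
  have Ui: "U $$ (0, 0) = c / q" "U $$ (0, Suc 0) = - s / q"
    "U $$ (Suc 0, 0) = s / q" "U $$ (Suc 0, Suc 0) = c / q"
    by (auto simp: U_def mat_of_rows_list_def)
  have Ud [simp]: "dim_row U = 2" "dim_col U = 2"
    using U by auto
  have q': "c * c + s * s = q * q" "a * a + b * b = p * p"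
    using assms by (auto simp: power2_eq_square)
  have unitary: "mat_adjoint U * U = 1\<^sub>m 2"
  proof (rule eq_matI)
    fix i j :: nat assume "i < dim_row (1\<^sub>m 2)" "j < dim_col (1\<^sub>m 2)"
    then have ij: "i < 2" "j < 2" by auto
    have "c / q * (c / q) + s / q * (s / q) = 1"
      using q q' by (simp add: field_simps)
    then have *: "complex_of_real c / q * (c / q) + s / q * (s / q) = 1"
      by (metis (no_types, lifting) of_real_1 of_real_add of_real_divide of_real_mult)
    show "(mat_adjoint U * U) $$ (i, j) = 1\<^sub>m 2 $$ (i, j)"
      using ij * by (auto simp: less_2_cases scalar_prod_def lessThan_2 mat_adjoint_index Ui add.commute)
  qed (use U in auto)
  have diag: "U * mat_diag 2 (\<lambda>i. complex_of_real (if i = 0 then r else 0)) * mat_adjoint U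
      = map_mat complex_of_real (outer2 (r / (q * q) * c) (r / (q * q) * s) c s)" for r
    unfolding mat_diag_mult_right[OF U]
    by (rule eq_matI) (auto simp: less_2_cases scalar_prod_def lessThan_2 mat_adjoint_index Ui)
  have "mat_adjoint ?A * ?A = map_mat complex_of_real (outer2 (p * p * c) (p * p * s) c s)"
  proof (rule eq_matI)
    fix i j :: nat
    assume "i < dim_row (map_mat complex_of_real (outer2 (p * p * c) (p * p * s) c s))"
      "j < dim_col (map_mat complex_of_real (outer2 (p * p * c) (p * p * s) c s))"
    then have ij: "i < 2" "j < 2" by auto
    then show "(mat_adjoint ?A * ?A) $$ (i, j)
        = map_mat complex_of_real (outer2 (p * p * c) (p * p * s) c s) $$ (i, j)"
      by (auto simp: less_2_cases scalar_prod_def lessThan_2 mat_adjoint_index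
        q'(2)[symmetric] algebra_simps)
  qed auto
  also have "\<dots> = U * mat_diag 2 (\<lambda>i. complex_of_real (if i = 0 then (p * q)\<^sup>2 else 0)) * mat_adjoint U"
    using q by (simp add: diag power2_eq_square)
  finally have "mat_abs ?A
      = U * mat_diag 2 (\<lambda>i. complex_of_real ((if i = 0 then (p * q)\<^sup>2 else 0) powr (1 / 2))) * mat_adjoint U"
    unfolding mat_abs_def by (intro psd_powr_eq[OF U unitary]) auto
  also have "(\<lambda>i. complex_of_real ((if i = 0 then (p * q)\<^sup>2 else 0) powr (1 / 2)))
      = (\<lambda>i. complex_of_real (if i = 0 then p * q else 0))"
    using p q by (auto simp: powr_half_sqrt)
  finally show ?thesis
    using q by (simp add: diag)
qed

section \<open>Numerical bounds\<close>

lemma less_powr_two_thirds: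
  fixes a N :: real
  assumes "0 \<le> a" "0 < N" "a ^ 3 < N\<^sup>2"
  shows "a < N powr (2 / 3)"
proof -
  have "(N powr (2 / 3)) ^ 3 = (N powr (2 / 3)) powr 3"
    using assms by simp
  also have "\<dots> = N\<^sup>2"
    using assms by (simp only: powr_powr) simp
  finally have "(N powr (2 / 3)) ^ 3 = N\<^sup>2" .
  then have "a ^ 3 < (N powr (2 / 3)) ^ 3"
    using assms by simp
  then show ?thesis
    by (rule power_less_imp_less_base) simp
qed

lemma powr_three_halves:
  assumes "0 \<le> x"
  shows "x powr (3 / 2) = sqrt x ^ 3"
proof (cases "x = 0")
  case False
  then have "sqrt x ^ 3 = (x powr (1 / 2)) powr 3"
    using assms by (simp add: powr_half_sqrt)
  then show ?thesis
    by (simp add: powr_powr)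
qed simp

text \<open>
  In terms of $y = \sqrt x$ the defining equation reads $y^2 (y - 2) = 1$. It forces $y > 2$, where
  the left-hand side increases strictly, so that the root is unique and any point with a value
  above $1$ bounds it; $22068 / 10000$ is such a point.
\<close>
lemma TZ_root_three_halves:
  defines "x \<equiv> TZ_root (3 / 2) 2"
  shows "1 < x" "x < 487 / 100" "x powr (3 / 2) = 2 * x + 1"
proof -
  let ?h = "\<lambda>y::real. y\<^sup>2 * (y - 2)"
  let ?P = "\<lambda>x::real. x > 1 \<and> x powr (3 / 2) - 2 * x - (real 2 - 1) = 0"
  have "\<exists>y\<ge>1. y \<le> 3 \<and> ?h y = 1"
    by (rule IVT) auto
  then obtain y where y: "1 \<le> y" "?h y = 1"
    by blast
  have y2: "2 < z" if "1 \<le> z" "?h z = 1" for z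
    using that by (smt (verit) mult_nonneg_nonpos zero_le_power2)
  have mono: "?h u < ?h v" if "2 < u" "u < v" for u v :: real
    using that by (intro mult_strict_mono power_strict_mono) auto
  have P: "1 < sqrt x \<and> ?h (sqrt x) = 1" if "?P x" for x
    using that by (auto simp: powr_three_halves power2_eq_square power3_eq_cube algebra_simps)
  have root: "?P (y\<^sup>2)"
    using y y2[OF y]
    by (auto simp: powr_three_halves power2_eq_square power3_eq_cube algebra_simps
        intro: less_1_mult)
  have "z = y\<^sup>2" if "?P z" for z
  proof -
    have "sqrt z = y"
      using P[OF that] y y2[OF y] y2[of "sqrt z"] mono[of y "sqrt z"] mono[of "sqrt z" y]
      by (cases "sqrt z" y rule: linorder_cases) auto
    then show ?thesis
      using that by auto
  qed
  with root have x: "x = y\<^sup>2"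
    unfolding x_def TZ_root_def by (intro the_equality) blast+
  show "1 < x" "x powr (3 / 2) = 2 * x + 1"
    using root unfolding x by auto
  have "y < 22068 / 10000"
  proof (rule ccontr)
    assume "\<not> y < 22068 / 10000"
    then have "?h (22068 / 10000) \<le> ?h y"
      by (intro mult_mono power_mono) auto
    then show False
      using y by (simp add: power2_eq_square)
  qed
  then have "y\<^sup>2 < (22068 / 10000)\<^sup>2"
    using y by (intro power_strict_mono) auto
  also have "\<dots> < 487 / 100"
    by (simp add: power2_eq_square)
  finally show "x < 487 / 100"
    by (simp add: x)
qed

text \<open>
  Substituting $x^{3/2} = 2 x + 1$ turns the denominator into $(2 x + 2)^{2/3}$, and the sixth
  power of the constant into $(2 x + 1)^2 / (16 (x + 1))$. The bound on the root gives a value of at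
  most about $1.228$ for it, while $(207 / 200)^6 > 1.229$.
\<close>
lemma TZ_const_three_halves: "TZ_const (3 / 2) 2 < 207 / 200"
proof -
  define x where "x = TZ_root (3 / 2) 2"
  note x = TZ_root_three_halves[folded x_def]
  define b where "b = sqrt (x * (x + 1)) / (207 / 200)"
  have x3: "x ^ 3 = (2 * x + 1)\<^sup>2"
  proof -
    have "(2 * x + 1)\<^sup>2 = (sqrt x ^ 3)\<^sup>2"
      using x by (simp add: powr_three_halves)
    also have "\<dots> = ((sqrt x)\<^sup>2) ^ 3"
      by (simp add: power_mult[symmetric] mult.commute)
    finally show ?thesis
      using x by simp
  qed
  have "(b ^ 3)\<^sup>2 = (b\<^sup>2) ^ 3"
    by (simp add: power_mult[symmetric] mult.commute)
  also have "\<dots> = (x + 1) ^ 3 * ((2 * x + 1)\<^sup>2 / (207 / 200) ^ 6)"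
    using x by (simp add: b_def power_divide power_mult_distrib x3)
  also have "\<dots> < (x + 1) ^ 3 * (16 * (x + 1))"
  proof (intro mult_strict_left_mono)
    \<comment> \<open>the second factor makes this, up to a constant, the difference of
        $(2 x + 1)^2$ and $19.668\,(x + 1)$, where $19.668$ is just below $16 (207 / 200)^6$\<close>
    have "(x - 487 / 100) * (4 * x + 3812 / 1000) < 0"
      using x by (intro mult_neg_pos) auto
    moreover have "(2 * x + 1)\<^sup>2
        = (x - 487 / 100) * (4 * x + 3812 / 1000) + (19668 / 1000 * x + 1956444 / 100000)"
      by (simp add: power2_eq_square field_simps)
    ultimately have "(2 * x + 1)\<^sup>2 < 19668 / 1000 * x + 1956444 / 100000"
      by (simp only: add_less_same_cancel2)
    also have "\<dots> < 19668 / 1000 * (x + 1)"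
      by simp
    also have "\<dots> \<le> (16 * (207 / 200) ^ 6) * (x + 1)"
      using x by (intro mult_right_mono) (auto simp: eval_nat_numeral)
    finally show "(2 * x + 1)\<^sup>2 / (207 / 200) ^ 6 < 16 * (x + 1)"
      by (simp add: field_simps)
  qed (use x in auto)
  also have "\<dots> = ((2 * x + 2)\<^sup>2)\<^sup>2"
    by (simp add: eval_nat_numeral algebra_simps)
  finally have "b ^ 3 < (2 * x + 2)\<^sup>2"
    by (rule power_less_imp_less_base) simp
  then have "b < (2 * x + 2) powr (2 / 3)"
    using x by (intro less_powr_two_thirds) (auto simp: b_def)
  moreover have "TZ_const (3 / 2) 2 = sqrt (x * (x + 1)) / (2 * x + 2) powr (2 / 3)"
    using x by (simp add: TZ_const_def Let_def x_def[symmetric] add.commute)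
  ultimately show ?thesis
    using x by (simp add: b_def pos_divide_less_eq mult.commute)
qed

lemma witness_ratio:
  "207 / 200 < ((2520 powr (3 / 2) + 208 powr (3 / 2)) powr (2 / 3)
     / (2250 powr (3 / 2) + 640 powr (3 / 2)) powr (2 / 3) :: real)"
proof -
  let ?N = "2520 powr (3 / 2) + 208 powr (3 / 2) :: real"
  let ?D = "2250 powr (3 / 2) + 640 powr (3 / 2) :: real"
  have up: "x powr (3 / 2) \<le> x * u" if "0 \<le> x" "0 \<le> u" "x \<le> u\<^sup>2" for x u :: real
    using that real_le_lsqrt[of u x]
    by (simp add: powr_three_halves power3_eq_cube mult_left_mono)
  have lo: "x * u \<le> x powr (3 / 2)" if "0 \<le> x" "0 \<le> u" "u\<^sup>2 \<le> x" for x u :: real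
    using that real_le_rsqrt[of u x]
    by (simp add: powr_three_halves power3_eq_cube mult_left_mono)
  \<comment> \<open>rational approximations of the square roots of $2520$, $208$, $2250$ and $640$\<close>
  have "2520 * (50199 / 1000) + 208 * (1442 / 100) \<le> ?N"
    by (intro add_mono lo) (auto simp: power2_eq_square)
  moreover have "?D \<le> 2250 * (47435 / 1000) + 640 * (25299 / 1000)"
    by (intro add_mono up) (auto simp: power2_eq_square)
  moreover have "?D > 0"
    by (simp add: add_pos_pos)
  ultimately have "105296 / 100000 * ?D \<le> ?N"
    by simp
  then have ND: "105296 / 100000 \<le> ?N / ?D"
    using \<open>?D > 0\<close> by (simp add: pos_le_divide_eq)
  \<comment> \<open>the bound $1.05296$ on the quotient is just above $(207 / 200)^{3/2}$\<close>
  have "(207 / 200 :: real) ^ 3 < (105296 / 100000)\<^sup>2"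
    by (simp add: eval_nat_numeral)
  also have "\<dots> \<le> (?N / ?D)\<^sup>2"
    using ND by (intro power_mono) auto
  finally have "207 / 200 < (?N / ?D) powr (2 / 3)"
    using ND by (intro less_powr_two_thirds) linarith+
  then show ?thesis
    by (simp add: powr_divide)
qed

section \<open>The counterexample\<close>

lemma best_const_two_ge:
  assumes n: "n \<ge> 1" and A: "A \<in> carrier_mat n n" and B: "B \<in> carrier_mat n n"
    and abs: "mat_abs A \<in> carrier_mat n n" "mat_abs B \<in> carrier_mat n n"
    and nz: "A \<noteq> 0\<^sub>m n n"
  shows "ereal (schatten_norm p (A + B) / schatten_norm p (mat_abs A + mat_abs B)) \<le> best_const p 2"
proof -
  let ?F = "\<lambda>k::nat. if k = 1 then A else B"
  let ?M = "module_mat TYPE(complex) n n"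
  interpret abelian_group ?M
    by (rule abelian_group_mat)
  have two: "{1..2} = {1, 2::nat}"
    by auto
  have sum: "(\<Oplus>\<^bsub>?M\<^esub>k\<in>{1..2}. G k) = G 1 + G 2"
    if "G 1 \<in> carrier_mat n n" "G 2 \<in> carrier_mat n n" for G :: "nat \<Rightarrow> complex mat"
    using that unfolding two by (simp add: finsum_insert module_mat_simps)
  show ?thesis
    unfolding best_const_def
    by (rule Sup_upper, rule CollectI, rule exI[of _ n], rule exI[of _ ?F])
       (use assms in \<open>auto simp: sum[unfolded One_nat_def] two\<close>)
qed

theorem theorem1p1:
  shows "(\<exists>A1 \<in> carrier_mat 2 2. \<exists>A2 \<in> carrier_mat 2 2.
            vec_space.rank 2 (A1 :: real mat) = 1 \<and> vec_space.rank 2 (A2 :: real mat) = 1 \<and>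
            (let B1 = map_mat complex_of_real A1; B2 = map_mat complex_of_real A2 in
              schatten_norm (3/2) (B1 + B2) / schatten_norm (3/2) (mat_abs B1 + mat_abs B2)
                > 207 / 200) \<and>
            207 / 200 > TZ_const (3/2) 2)
       \<and> \<not> (\<forall>m\<ge>2. \<forall>p>1. best_const p m = ereal (TZ_const p m))"
proof -
  let ?A1 = "outer2 84 13 15 8" and ?A2 = "outer2 84 (-13) 15 (-8)"
  let ?B1 = "map_mat complex_of_real ?A1" and ?B2 = "map_mat complex_of_real ?A2"
  let ?D = "\<lambda>x y. mat_diag 2 (\<lambda>i. complex_of_real (if i = 0 then x else y))"
  \<comment> \<open>a nonsingular sum of two matrices of rank at most one forces both ranks to be one\<close>
  have "det (?A1 + ?A2) \<noteq> 0"
    by (subst det_upper_triangular[of _ 2]) (auto simp: less_2_cases diag_mat_def upper_triangular_def upt_rec)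
  then have "vec_space.rank 2 (?A1 + ?A2) = 2"
    by (subst vec_space.det_rank_iff[symmetric]) auto
  then have "2 \<le> vec_space.rank 2 ?A1 + vec_space.rank 2 ?A2"
    using vec_space.rank_subadditive[of ?A1 2 2 ?A2] by simp
  then have rank: "vec_space.rank 2 ?A1 = 1" "vec_space.rank 2 ?A2 = 1"
    using rank_outer2_le[of 84 13 15 8] rank_outer2_le[of 84 "-13" 15 "-8"] by auto
  have abs: "mat_abs ?B1 = map_mat complex_of_real (outer2 75 40 15 8)"
    "mat_abs ?B2 = map_mat complex_of_real (outer2 75 (-40) 15 (-8))"
    using mat_abs_outer2[of 85 84 13 17 15 8] mat_abs_outer2[of 85 84 "-13" 17 15 "-8"] by auto
  have num: "?B1 + ?B2 = ?D 2520 208"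
    by (rule eq_matI) (auto simp: less_2_cases mat_diag_def)
  have den: "mat_abs ?B1 + mat_abs ?B2 = ?D 2250 640"
    unfolding abs by (rule eq_matI) (auto simp: less_2_cases mat_diag_def)
  have norm: "schatten_norm (3 / 2) (?D x y) = (x powr (3 / 2) + y powr (3 / 2)) powr (2 / 3)"
    if "0 \<le> x" "0 \<le> y" for x y
    using that by (subst schatten_norm_mat_diag) (auto simp: lessThan_2)
  have ratio: "207 / 200
      < schatten_norm (3 / 2) (?B1 + ?B2) / schatten_norm (3 / 2) (mat_abs ?B1 + mat_abs ?B2)"
    using witness_ratio unfolding num den by (simp add: norm)
  have "?B1 \<noteq> 0\<^sub>m 2 2"
  proof
    assume "?B1 = 0\<^sub>m 2 2"
    then have "?B1 $$ (0, 0) = 0\<^sub>m 2 2 $$ (0, 0)"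
      by simp
    then show False
      by simp
  qed
  then have "ereal (schatten_norm (3 / 2) (?B1 + ?B2) / schatten_norm (3 / 2) (mat_abs ?B1 + mat_abs ?B2))
      \<le> best_const (3 / 2) 2"
    by (intro best_const_two_ge) (auto simp: abs)
  then have "ereal (207 / 200) < best_const (3 / 2) 2"
    using ratio by (meson ereal_less_eq(3) less_ereal.simps(1) less_le_trans)
  moreover have "ereal (TZ_const (3 / 2) 2) < ereal (207 / 200)"
    using TZ_const_three_halves by simp
  ultimately have "best_const (3 / 2) 2 \<noteq> ereal (TZ_const (3 / 2) 2)"
    by auto
  then have "\<not> (\<forall>m\<ge>2. \<forall>p>1. best_const p m = ereal (TZ_const p m))"
    by (intro notI) (auto dest!: spec[of _ 2] spec[of _ "3 / 2"])
  then show ?thesis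
    using rank ratio TZ_const_three_halves
    by (intro conjI bexI[of _ ?A1] bexI[of _ ?A2]) (auto simp: Let_def)
qed

end
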